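(* For every $n\ge1$, the number of bounded affine permutations of size $n$ satisfies (a) $|\widetilde{S}^{/\!/}_n|=\sum_{m=0}^n\binom{n}{m}\sum_{k=0}^m\binom{m}{k}d(m,k)$; (b) $|\widetilde{S}^{/\!/}_n|=\sum_{m=0}^n\binom{n}{m}\sum_{k=0}^m\binom{m}{n-k}(-1)^{n-m}a(m,k)$.
   Context: An affine permutation of size $n$ is a bijection $\sigma:\mathbb{Z}\to\mathbb{Z}$ with $\sigma(i+n)=\sigma(i)+n$ for all $i$ and $\sum_{i=1}^n\sigma(i)=\sum_{i=1}^ni$. It is bounded if $|\sigma(i)-i|<n$ for all $i$, and $\widetilde{S}^{/\!/}_n$ is the set of bounded affine permutations of size $n$. An excedance of $\pi\in S_m$ is an $i$ with $\pi(i)>i$. $a(m,k)$ is the number of permutations in $S_m$ with $k$ excedances, and $d(m,k)$ is the number of derangements (fixed-point-free permutations) in $S_m$ with $k$ excedances, with $a(0,0)=d(0,0)=1$. Binomial coefficients $\binom{m}{j}$ are $0$ unless $0\le j\le m$. *)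

theory Defs
  imports Complex_Main "HOL-Combinatorics.Permutations"
begin

definition affine_permutation :: "nat \<Rightarrow> (int \<Rightarrow> int) \<Rightarrow> bool" where
  "affine_permutation n \<sigma> \<longleftrightarrow>
     bij \<sigma> \<and>
     (\<forall>i. \<sigma> (i + int n) = \<sigma> i + int n) \<and>
     (\<Sum>i = 1..int n. \<sigma> i) = (\<Sum>i = 1..int n. i)"

definition bounded_affine_permutations :: "nat \<Rightarrow> (int \<Rightarrow> int) set" where
  "bounded_affine_permutations n =
     {\<sigma>. affine_permutation n \<sigma> \<and> (\<forall>i. \<bar>\<sigma> i - i\<bar> < int n)}"

text \<open>
  Elements of \<open>S\<^sub>m\<close> are represented as functions on \<^typ>\<open>nat\<close> permuting \<open>{1..m}\<close> (and fixing
  everything outside it), so excedances and fixed points are only counted inside \<open>{1..m}\<close>.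
\<close>

definition excedances :: "nat \<Rightarrow> (nat \<Rightarrow> nat) \<Rightarrow> nat set" where
  "excedances m \<pi> = {i \<in> {1..m}. \<pi> i > i}"

definition derangement :: "nat \<Rightarrow> (nat \<Rightarrow> nat) \<Rightarrow> bool" where
  "derangement m \<pi> \<longleftrightarrow> \<pi> permutes {1..m} \<and> (\<forall>i\<in>{1..m}. \<pi> i \<noteq> i)"

definition num_perms_exc :: "nat \<Rightarrow> nat \<Rightarrow> nat" where
  "num_perms_exc m k = card {\<pi>. \<pi> permutes {1..m} \<and> card (excedances m \<pi>) = k}"

definition num_derangements_exc :: "nat \<Rightarrow> nat \<Rightarrow> nat" where
  "num_derangements_exc m k = card {\<pi>. derangement m \<pi> \<and> card (excedances m \<pi>) = k}"

text \<open>The usual conventions for the empty permutation hold without a special case.\<close>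

lemma num_perms_exc_0_0: "num_perms_exc 0 0 = 1"
  by (simp add: num_perms_exc_def excedances_def)

lemma num_derangements_exc_0_0: "num_derangements_exc 0 0 = 1"
  by (simp add: num_derangements_exc_def derangement_def excedances_def)

end

theory Submission
  imports Defs "HOL-Library.Infinite_Set"
begin

text \<open>
  Reducing a bounded affine permutation \<open>\<sigma>\<close> modulo \<open>n\<close> gives \<open>\<pi> \<in> S\<^sub>n\<close>, and boundedness leaves
  exactly two lifts of \<open>\<pi> i\<close>, one above and one below \<open>i\<close>, when \<open>\<pi> i \<noteq> i\<close>, and only one when
  \<open>\<pi> i = i\<close>. So \<open>\<sigma>\<close> is determined by \<open>\<pi>\<close> and the set \<open>T\<close> of those \<open>i \<in> {1..n}\<close> with \<open>\<sigma> i > i\<close>, an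
  arbitrary set of moved points of \<open>\<pi>\<close>; the condition on the sum says that \<open>T\<close> has as many elements
  as \<open>\<pi>\<close> has excedances. Grouping the pairs \<open>(\<pi>, T)\<close> by the set of moved points gives (a). For (b),
  expand the permutation numbers as \<open>a(m,k) = \<Sum>\<^sub>j (m choose j) d(j,k)\<close>; the coefficient of \<open>d(j,k)\<close>
  becomes an \<open>(n - j)\<close>-th finite difference of \<open>x \<mapsto> (x choose (n - k))\<close>.
\<close>

section \<open>Permutations by moved points and excedances\<close>

definition moved :: "nat \<Rightarrow> (nat \<Rightarrow> nat) \<Rightarrow> nat set" where
  "moved n \<pi> = {i \<in> {1..n}. \<pi> i \<noteq> i}"

lemma moved_subset: "moved n \<pi> \<subseteq> {1..n}"
  by (auto simp: moved_def)

lemma excedances_subset_moved: "excedances n \<pi> \<subseteq> moved n \<pi>"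
  by (auto simp: moved_def excedances_def)

lemma card_excedances_le_moved: "card (excedances n \<pi>) \<le> card (moved n \<pi>)"
  by (intro card_mono excedances_subset_moved finite_subset[OF moved_subset]) simp

lemma card_moved_le: "card (moved n \<pi>) \<le> n"
  using card_mono[OF _ moved_subset[of n \<pi>]] by simp

lemma card_excedances_le: "card (excedances n \<pi>) \<le> n"
  using card_excedances_le_moved card_moved_le by (rule order_trans)

lemma num_perms_exc_eq_0: "m < k \<Longrightarrow> num_perms_exc m k = 0"
  using card_excedances_le[of m] by (auto simp: num_perms_exc_def card_eq_0_iff dest: leD)

lemma num_derangements_exc_eq_0: "m < k \<Longrightarrow> num_derangements_exc m k = 0"
  using card_excedances_le[of m] by (auto simp: num_derangements_exc_def card_eq_0_iff dest: leD)

text \<open>Fixed points and excedances depend only on the order of the ground set, so conjugation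
  with the increasing enumeration of \<open>M\<close> carries the count over to
  \<open>{1..card M}\<close>.\<close>

lemma card_fixpoint_free_permutations_exc:
  fixes M :: "nat set"
  assumes "finite M"
  shows "card {\<pi>. \<pi> permutes M \<and> (\<forall>i\<in>M. \<pi> i \<noteq> i) \<and> card {i \<in> M. i < \<pi> i} = k}
           = num_derangements_exc (card M) k"
proof -
  define A where "A = {1..card M}"
  obtain h where h: "bij_betw h {..<card M} M" "strict_mono_on {..<card M} h"
    using ex_bij_betw_strict_mono_card[OF assms] .
  \<comment> \<open>\<open>h\<close> counts from 0, whereas permutations here live on
    \<open>{1..card M}\<close>; hence the shift by one.\<close>
  define f where "f = (\<lambda>i. h (i - 1))"
  have "bij_betw (\<lambda>i. i - 1) A {..<card M}"
    by (rule bij_betw_byWitness[where f' = Suc]) (auto simp: A_def)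
  then have f: "bij_betw f A M"
    unfolding f_def using bij_betw_trans[OF _ h(1)] by (simp add: o_def)
  have less: "f i < f j \<longleftrightarrow> i < j" if "i \<in> A" "j \<in> A" for i j
  proof -
    have "h (i - 1) < h (j - 1) \<longleftrightarrow> i - 1 < j - 1"
      using that by (intro strict_mono_on_less[OF h(2)]) (auto simp: A_def)
    then show ?thesis using that by (auto simp: A_def f_def)
  qed
  \<comment> \<open>Conjugation by \<open>f\<close>, extended by the identity outside
    \<open>M\<close>, as \<open>permutes\<close> requires.\<close>
  define \<Phi> where "\<Phi> = (\<lambda>\<pi> x. if x \<in> M then f (\<pi> (inv_into A f x)) else x)"
  have \<Phi>: "bij_betw \<Phi> {\<pi>. \<pi> permutes A} {\<pi>. \<pi> permutes M}"
    unfolding \<Phi>_def by (rule bij_betw_permutations[OF f])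
  have M: "M = f ` A" using f by (simp add: bij_betw_def)
  have inj: "inj_on f A" using f by (simp add: bij_betw_def)
  have \<Phi>f: "\<Phi> \<pi> (f i) = f (\<pi> i)" if "i \<in> A" for \<pi> i
    using that M inj by (simp add: \<Phi>_def)
  have eq: "((\<forall>i\<in>M. \<Phi> \<pi> i \<noteq> i) \<and> card {i \<in> M. i < \<Phi> \<pi> i} = k) \<longleftrightarrow>
      ((\<forall>i\<in>A. \<pi> i \<noteq> i) \<and> card (excedances (card M) \<pi>) = k)"
    if "\<pi> \<in> {\<pi>. \<pi> permutes A}" for \<pi>
  proof -
    have in_A: "\<pi> i \<in> A" if "i \<in> A" for i
      using \<open>\<pi> \<in> _\<close> that by (simp add: permutes_in_image)
    have "(\<forall>i\<in>M. \<Phi> \<pi> i \<noteq> i) \<longleftrightarrow> (\<forall>i\<in>A. \<pi> i \<noteq> i)"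
      unfolding M using \<Phi>f in_A inj by (auto simp: inj_on_def)
    moreover have "{i \<in> M. i < \<Phi> \<pi> i} = f ` excedances (card M) \<pi>"
    proof -
      have "excedances (card M) \<pi> = {i \<in> A. i < \<pi> i}" by (simp add: excedances_def A_def)
      moreover have "{i \<in> M. i < \<Phi> \<pi> i} = f ` {i \<in> A. f i < \<Phi> \<pi> (f i)}"
        unfolding M by auto
      moreover have "f i < \<Phi> \<pi> (f i) \<longleftrightarrow> i < \<pi> i" if "i \<in> A" for i
        using that \<Phi>f in_A less by simp
      ultimately show ?thesis by (metis (mono_tags, lifting) Collect_cong)
    qed
    moreover have "inj_on f (excedances (card M) \<pi>)"
      by (rule inj_on_subset[OF inj]) (auto simp: excedances_def A_def)
    ultimately show ?thesis by (simp add: card_image)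
  qed
  have "card {\<pi> \<in> {\<pi>. \<pi> permutes A}. (\<forall>i\<in>A. \<pi> i \<noteq> i) \<and> card (excedances (card M) \<pi>) = k}
      = card {\<pi> \<in> {\<pi>. \<pi> permutes M}. (\<forall>i\<in>M. \<pi> i \<noteq> i) \<and> card {i \<in> M. i < \<pi> i} = k}"
    by (rule bij_betw_same_card[where f = \<Phi>], rule bij_betw_Collect[OF \<Phi>]) (rule eq)
  then show ?thesis
    by (simp add: num_derangements_exc_def derangement_def A_def conj_assoc)
qed

lemma sum_over_Pow_by_card:
  fixes h :: "nat \<Rightarrow> nat"
  assumes "finite A"
  shows "(\<Sum>M\<in>Pow A. h (card M)) = (\<Sum>m=0..card A. (card A choose m) * h m)"
proof -
  have "(\<Sum>M\<in>Pow A. h (card M)) = (\<Sum>m=0..card A. \<Sum>M\<in>{M \<in> Pow A. card M = m}. h (card M))"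
    using assms by (subst sum.group) (auto intro: card_mono)
  also have "\<dots> = (\<Sum>m=0..card A. (card A choose m) * h m)"
    by (intro sum.cong) (simp_all add: n_subsets[OF assms, symmetric])
  finally show ?thesis .
qed

text \<open>A permutation is the same as its set \<open>M\<close> of moved points together with a
  fixed-point-free permutation of \<open>M\<close>. The weight \<open>g\<close> is left free for two
  uses: a binomial coefficient for (a), and an indicator to expand
  \<open>num_perms_exc\<close>.\<close>

lemma sum_permutations_by_moved:
  fixes g :: "nat \<Rightarrow> nat \<Rightarrow> nat"
  shows "(\<Sum>\<pi> | \<pi> permutes {1..n}. g (card (moved n \<pi>)) (card (excedances n \<pi>)))
           = (\<Sum>m=0..n. (n choose m) * (\<Sum>k=0..m. g m k * num_derangements_exc m k))"
    (is "?L = ?R")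
proof -
  let ?P = "{\<pi>. \<pi> permutes {1..n}}"
  have fin: "finite ?P" by (simp add: finite_permutations)
  have "?L = (\<Sum>M\<in>Pow {1..n}. \<Sum>\<pi>\<in>{\<pi> \<in> ?P. moved n \<pi> = M}.
               g (card (moved n \<pi>)) (card (excedances n \<pi>)))"
    using moved_subset by (intro sum.group[symmetric] fin) auto
  also have "\<dots> = (\<Sum>M\<in>Pow {1..n}. \<Sum>k=0..card M. g (card M) k * num_derangements_exc (card M) k)"
  proof (intro sum.cong refl)
    fix M assume "M \<in> Pow {1..n}"
    then have M: "M \<subseteq> {1..n}" "finite M" by (auto intro: finite_subset)
    let ?D = "{\<pi>. \<pi> permutes M \<and> (\<forall>i\<in>M. \<pi> i \<noteq> i)}"
    have D: "{\<pi> \<in> ?P. moved n \<pi> = M} = ?D"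
    proof (intro set_eqI iffI)
      fix \<pi> assume "\<pi> \<in> {\<pi> \<in> ?P. moved n \<pi> = M}"
      then have \<pi>: "\<pi> permutes {1..n}" "moved n \<pi> = M" by auto
      have "\<pi> permutes M"
        using \<pi> by (intro permutes_superset[OF \<pi>(1)]) (auto simp: moved_def)
      then show "\<pi> \<in> ?D" using \<pi> by (auto simp: moved_def)
    next
      fix \<pi> assume \<pi>: "\<pi> \<in> ?D"
      then show "\<pi> \<in> {\<pi> \<in> ?P. moved n \<pi> = M}"
        using M by (auto simp: moved_def intro: permutes_subset dest: permutes_not_in)
    qed
    have exc: "excedances n \<pi> = {i \<in> M. i < \<pi> i}" if "moved n \<pi> = M" for \<pi>
      using that by (auto simp: moved_def excedances_def)
    let ?S = "{\<pi> \<in> ?P. moved n \<pi> = M}"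
    have "(\<Sum>\<pi>\<in>?S. g (card (moved n \<pi>)) (card (excedances n \<pi>)))
        = (\<Sum>\<pi>\<in>?S. g (card M) (card {i \<in> M. i < \<pi> i}))"
      by (intro sum.cong refl) (auto simp: exc)
    also have "\<dots> = (\<Sum>k=0..card M. \<Sum>\<pi>\<in>{\<pi> \<in> ?S. card {i \<in> M. i < \<pi> i} = k}.
                      g (card M) (card {i \<in> M. i < \<pi> i}))"
      using M fin by (intro sum.group[symmetric]) (auto intro: card_mono)
    also have "\<dots> = (\<Sum>k=0..card M. g (card M) k * num_derangements_exc (card M) k)"
    proof (intro sum.cong refl)
      fix k
      have "{\<pi> \<in> ?S. card {i \<in> M. i < \<pi> i} = k}
          = {\<pi>. \<pi> permutes M \<and> (\<forall>i\<in>M. \<pi> i \<noteq> i) \<and> card {i \<in> M. i < \<pi> i} = k}"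
        unfolding D by auto
      then show "(\<Sum>\<pi>\<in>{\<pi> \<in> ?S. card {i \<in> M. i < \<pi> i} = k}. g (card M) (card {i \<in> M. i < \<pi> i}))
          = g (card M) k * num_derangements_exc (card M) k"
        using card_fixpoint_free_permutations_exc[OF M(2), of k] by simp
    qed
    finally show "(\<Sum>\<pi>\<in>?S. g (card (moved n \<pi>)) (card (excedances n \<pi>)))
        = (\<Sum>k=0..card M. g (card M) k * num_derangements_exc (card M) k)" .
  qed
  also have "\<dots> = ?R"
    using sum_over_Pow_by_card[of "{1..n}" "\<lambda>m. \<Sum>k=0..m. g m k * num_derangements_exc m k"]
    by simp
  finally show ?thesis .
qed

lemma num_perms_exc_eq_sum_derangements:
  "num_perms_exc n k = (\<Sum>m=0..n. (n choose m) * num_derangements_exc m k)"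
proof -
  have "num_perms_exc n k = (\<Sum>\<pi> | \<pi> permutes {1..n}. of_bool (card (excedances n \<pi>) = k))"
    by (simp add: num_perms_exc_def finite_permutations Int_def)
  also have "\<dots> = (\<Sum>m=0..n. (n choose m) *
      (\<Sum>l=0..m. of_bool (l = k) * num_derangements_exc m l))"
    by (rule sum_permutations_by_moved[where g = "\<lambda>_ l. of_bool (l = k)"])
  also have "\<dots> = (\<Sum>m=0..n. (n choose m) * num_derangements_exc m k)"
    \<comment> \<open>The indicator selects \<open>l = k\<close>; if \<open>k > m\<close> this index
      is out of range, but then \<open>num_derangements_exc m k\<close> is 0 as well.\<close>
    by (intro sum.cong refl arg_cong2[where f = "(*)"])
       (auto simp: of_bool_def if_distrib[of "\<lambda>x. x * _"] num_derangements_exc_eq_0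
             cong: if_cong)
  finally show ?thesis .
qed

section \<open>The alternating sum\<close>

text \<open>The left side is the \<open>p\<close>-th forward difference of
  \<open>y \<mapsto> (y choose (r + p))\<close> at \<open>x\<close>; by Pascal's rule each
  difference lowers the bottom index by one.\<close>

lemma finite_difference_binomial:
  "(\<Sum>i\<le>p. (-1) ^ (p - i) * int (p choose i) * int ((x + i) choose (r + p))) = int (x choose r)"
proof (induction p arbitrary: x r)
  case 0
  show ?case by simp
next
  case (Suc p)
  let ?t = "\<lambda>i. int ((x + i) choose (r + Suc p))"
  have "(\<Sum>i\<le>Suc p. (-1) ^ (Suc p - i) * int (Suc p choose i) * ?t i)
      = (-1) ^ Suc p * ?t 0 + (\<Sum>i\<le>p. (-1) ^ (p - i) * int (Suc p choose Suc i) * ?t (Suc i))"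
    by (subst sum.atMost_Suc_shift) simp
  \<comment> \<open>Pascal's rule on \<open>Suc p choose Suc i\<close> writes the difference of
    order \<open>Suc p\<close> as a \<open>p\<close>-th difference at \<open>Suc x\<close> minus one
    at \<open>x\<close>. The isolated term \<open>?t 0\<close> belongs to the latter.\<close>
  also have "\<dots> = (\<Sum>i\<le>p. (-1) ^ (p - i) * int (p choose i) * ?t (Suc i))
      + ((-1) ^ Suc p * ?t 0 + (\<Sum>i\<le>p. (-1) ^ (p - i) * int (p choose Suc i) * ?t (Suc i)))"
    by (simp add: sum.distrib algebra_simps)
  also have "(-1) ^ Suc p * ?t 0 + (\<Sum>i\<le>p. (-1) ^ (p - i) * int (p choose Suc i) * ?t (Suc i))
      = (\<Sum>i\<le>Suc p. (-1) ^ (Suc p - i) * int (p choose i) * ?t i)"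
    by (subst sum.atMost_Suc_shift) simp
  \<comment> \<open>The top term vanishes because \<open>p choose Suc p\<close> is 0, and each
    remaining sign flips.\<close>
  also have "\<dots> = - (\<Sum>i\<le>p. (-1) ^ (p - i) * int (p choose i) * ?t i)"
    by (simp add: Suc_diff_le sum_negf)
  finally show ?case
    \<comment> \<open>What is left is
      \<open>(Suc x choose Suc r) - (x choose Suc r) = (x choose r)\<close>.\<close>
    using Suc.IH[of x "Suc r"] Suc.IH[of "Suc x" "Suc r"] by simp
qed

text \<open>Since \<open>(n choose m) (m choose j) = (n choose j) ((n - j) choose (m - j))\<close>,
  the sum is \<open>n choose j\<close> times an \<open>(n - j)\<close>-th finite difference at
  \<open>j\<close>. It evaluates to \<open>j choose (j - k)\<close>, which is
  \<open>j choose k\<close>.\<close>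

lemma alternating_binomial_sum:
  assumes "k \<le> j" "j \<le> n"
  shows "(\<Sum>m=j..n. (-1) ^ (n - m) * int (n choose m) * int (m choose j) * int (m choose (n - k)))
           = int (n choose j) * int (j choose k)"
proof -
  define p where "p = n - j"
  have n: "n = j + p" using assms by (simp add: p_def)
  have "(\<Sum>m=j..n. (-1) ^ (n - m) * int (n choose m) * int (m choose j) * int (m choose (n - k)))
      = (\<Sum>i\<le>p. (-1) ^ (p - i) * int (n choose (j + i)) * int ((j + i) choose j)
          * int ((j + i) choose (n - k)))"
    unfolding n
    by (rule sum.reindex_bij_witness[of _ "\<lambda>i. j + i" "\<lambda>m. m - j"]) (auto simp: add.commute)
  also have "\<dots> = (\<Sum>i\<le>p. int (n choose j) *
      ((-1) ^ (p - i) * int (p choose i) * int ((j + i) choose ((j - k) + p))))"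
  proof (intro sum.cong refl)
    fix i assume "i \<in> {..p}"
    then have "(n choose (j + i)) * ((j + i) choose j) = (n choose j) * (p choose i)"
      using choose_mult[of j "j + i" n] by (simp add: n)
    then have "int (n choose (j + i)) * int ((j + i) choose j) = int (n choose j) * int (p choose i)"
      by (metis of_nat_mult)
    moreover have "n - k = (j - k) + p" using assms n by simp
    ultimately show "(-1) ^ (p - i) * int (n choose (j + i)) * int ((j + i) choose j)
          * int ((j + i) choose (n - k)) = int (n choose j) *
      ((-1) ^ (p - i) * int (p choose i) * int ((j + i) choose ((j - k) + p)))"
      by (simp add: mult.assoc mult.left_commute)
  qed
  also have "\<dots> = int (n choose j) * int (j choose (j - k))"
    by (simp only: sum_distrib_left[symmetric] finite_difference_binomial)
  finally show ?thesis using binomial_symmetric[OF assms(1)] by simp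
qed

text \<open>This identifies the right-hand sides of (a) and (b) with no reference to affine
  permutations: expand the permutation numbers, sum over \<open>m\<close> first, and compare
  coefficients of \<open>?d j k\<close>.\<close>

lemma sum_derangements_eq_alternating_sum_permutations:
  "int (\<Sum>m=0..n. (n choose m) * (\<Sum>k=0..m. (m choose k) * num_derangements_exc m k))
     = (\<Sum>m=0..n. int (n choose m) *
         (\<Sum>k=0..m. int (m choose (n - k)) * (-1) ^ (n - m) * int (num_perms_exc m k)))"
    (is "?L = ?R")
proof -
  let ?d = "\<lambda>j k. int (num_derangements_exc j k)"
  let ?c = "\<lambda>m j k. (-1) ^ (n - m) * int (n choose m) * int (m choose j) * int (m choose (n - k))"
  \<comment> \<open>All three ranges are enlarged to \<open>{0..n}\<close> so that the sums can be
    exchanged freely. The added terms vanish, since \<open>num_perms_exc m k\<close> is 0 for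
    \<open>k > m\<close> and \<open>m choose j\<close> is 0 for \<open>j > m\<close>.\<close>
  have "?R = (\<Sum>m=0..n. \<Sum>k=0..n. \<Sum>j=0..n. ?c m j k * ?d j k)"
  proof (intro sum.cong refl)
    fix m assume m: "m \<in> {0..n}"
    have "int (n choose m) * (\<Sum>k=0..m. int (m choose (n - k)) * (-1) ^ (n - m) * int (num_perms_exc m k))
        = (\<Sum>k=0..m. int (n choose m) * int (m choose (n - k)) * (-1) ^ (n - m) * int (num_perms_exc m k))"
      by (simp add: sum_distrib_left mult.assoc)
    also have "\<dots> = (\<Sum>k=0..n. int (n choose m) * int (m choose (n - k)) * (-1) ^ (n - m) * int (num_perms_exc m k))"
      using m by (intro sum.mono_neutral_left) (auto simp: num_perms_exc_eq_0)
    also have "\<dots> = (\<Sum>k=0..n. \<Sum>j=0..n. ?c m j k * ?d j k)"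
    proof (intro sum.cong refl)
      fix k
      have "int (num_perms_exc m k) = (\<Sum>j=0..m. int (m choose j) * ?d j k)"
        by (simp add: num_perms_exc_eq_sum_derangements)
      also have "\<dots> = (\<Sum>j=0..n. int (m choose j) * ?d j k)"
        using m by (intro sum.mono_neutral_left) auto
      finally show "int (n choose m) * int (m choose (n - k)) * (-1) ^ (n - m) * int (num_perms_exc m k)
          = (\<Sum>j=0..n. ?c m j k * ?d j k)"
        by (simp add: sum_distrib_left mult_ac)
    qed
    finally show "int (n choose m) * (\<Sum>k=0..m. int (m choose (n - k)) * (-1) ^ (n - m) * int (num_perms_exc m k))
        = (\<Sum>k=0..n. \<Sum>j=0..n. ?c m j k * ?d j k)" .
  qed
  also have "\<dots> = (\<Sum>k=0..n. \<Sum>m=0..n. \<Sum>j=0..n. ?c m j k * ?d j k)"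
    by (rule sum.swap)
  also have "\<dots> = (\<Sum>k=0..n. \<Sum>j=0..n. \<Sum>m=0..n. ?c m j k * ?d j k)"
    by (intro sum.cong refl sum.swap)
  also have "\<dots> = (\<Sum>j=0..n. \<Sum>k=0..n. \<Sum>m=0..n. ?c m j k * ?d j k)"
    by (rule sum.swap)
  also have "\<dots> = (\<Sum>j=0..n. \<Sum>k=0..n. int (n choose j) * int (j choose k) * ?d j k)"
  proof (intro sum.cong refl)
    fix j k assume j: "j \<in> {0..n}"
    have "(\<Sum>m=0..n. ?c m j k * ?d j k) = (\<Sum>m=j..n. ?c m j k) * ?d j k"
      unfolding sum_distrib_right by (intro sum.mono_neutral_right) auto
    also have "\<dots> = int (n choose j) * int (j choose k) * ?d j k"
      \<comment> \<open>The binomial identity covers \<open>k \<le> j\<close>; for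
        \<open>k > j\<close> both sides contain the factor \<open>?d j k\<close>, which is
        0.\<close>
      using alternating_binomial_sum[of k j n] j
      by (cases "k \<le> j") (simp_all add: num_derangements_exc_eq_0)
    finally show "(\<Sum>m=0..n. ?c m j k * ?d j k) = int (n choose j) * int (j choose k) * ?d j k" .
  qed
  also have "\<dots> = (\<Sum>j=0..n. \<Sum>k=0..j. int (n choose j) * int (j choose k) * ?d j k)"
    by (intro sum.cong sum.mono_neutral_right refl) auto
  also have "\<dots> = ?L" by (simp add: sum_distrib_left mult.assoc)
  finally show ?thesis by simp
qed

section \<open>Affine permutations and residues\<close>

text \<open>Representatives are taken in \<open>{1..n}\<close> to match the ground set of the
  permutations. This accounts for the shift by one here and for the quotient
  \<open>(x - 1) div int n\<close> that goes with it.\<close>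

definition residue :: "nat \<Rightarrow> int \<Rightarrow> nat" where
  "residue n x = nat ((x - 1) mod int n + 1)"

lemma residue_range:
  assumes "n \<ge> 1"
  shows "residue n x \<in> {1..n}"
proof -
  have "0 \<le> (x - 1) mod int n" "(x - 1) mod int n < int n" using assms by simp_all
  then show ?thesis unfolding residue_def atLeastAtMost_iff by linarith
qed

lemma residue_decomp:
  assumes "n \<ge> 1"
  shows "x = int (residue n x) + int n * ((x - 1) div int n)"
  using assms pos_mod_sign[of "int n" "x - 1"] mult_div_mod_eq[of "int n" "x - 1"]
  unfolding residue_def by simp

lemma quotient_eq:
  assumes "r \<in> {1..n}"
  shows "(int r + int n * k - 1) div int n = k"
proof -
  have "(int r + int n * k - 1) div int n = ((int r - 1) + k * int n) div int n"
    by (simp add: algebra_simps)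
  also have "\<dots> = k + (int r - 1) div int n"
    using assms by (intro div_mult_self1) auto
  finally show ?thesis using assms by simp
qed

lemma residue_eq:
  assumes "r \<in> {1..n}"
  shows "residue n (int r + int n * k) = r"
  using residue_decomp[of n "int r + int n * k"] quotient_eq[OF assms, of k] assms by simp

lemma shift_multiple:
  assumes "\<And>i. \<sigma> (i + int n) = \<sigma> i + int n"
  shows "\<sigma> (i + int n * k) = \<sigma> i + int n * k"
proof (induction k arbitrary: i rule: int_induct[where k = 0])
  case base
  show ?case by simp
next
  case (step1 k)
  then show ?case using assms[of "i + int n * k"] by (simp add: algebra_simps)
next
  case (step2 k)
  then show ?case using assms[of "i + int n * (k - 1)"] by (simp add: algebra_simps)
qed

lemma shift_equivariant_ext:
  assumes "n \<ge> 1" and "\<And>i. \<sigma> (i + int n) = \<sigma> i + int n" and "\<And>i. \<tau> (i + int n) = \<tau> i + int n"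
    and "\<And>r. r \<in> {1..n} \<Longrightarrow> \<sigma> (int r) = \<tau> (int r)"
  shows "\<sigma> = \<tau>"
proof
  fix x
  show "\<sigma> x = \<tau> x"
    using shift_multiple[of \<sigma> n, OF assms(2)] shift_multiple[of \<tau> n, OF assms(3)]
      assms(4)[OF residue_range[OF assms(1), of x]] residue_decomp[OF assms(1), of x] by metis
qed

lemma sum_int_interval: "(\<Sum>i=1..int n. f i) = (\<Sum>r=1..n. f (int r))"
  by (rule sum.reindex_bij_witness[of _ int nat]) auto

section \<open>The correspondence between affine permutations and pairs
  \<open>(\<pi>, T)\<close>\<close>

definition residue_perm :: "nat \<Rightarrow> (int \<Rightarrow> int) \<Rightarrow> nat \<Rightarrow> nat" where
  "residue_perm n \<sigma> r = (if r \<in> {1..n} then residue n (\<sigma> (int r)) else r)"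

definition ascents :: "nat \<Rightarrow> (int \<Rightarrow> int) \<Rightarrow> nat set" where
  "ascents n \<sigma> = {r \<in> {1..n}. int r < \<sigma> (int r)}"

text \<open>The periodic extension of \<open>\<pi>\<close>, corrected by multiples of
  \<open>n\<close>. The uncorrected value at \<open>r\<close> in \<open>{1..n}\<close> exceeds
  \<open>r\<close> exactly at excedances; the middle term raises it by \<open>n\<close> on
  \<open>T\<close> minus the excedances and lowers it by \<open>n\<close> on the excedances minus
  \<open>T\<close>.\<close>

definition affine_of :: "nat \<Rightarrow> (nat \<Rightarrow> nat) \<Rightarrow> nat set \<Rightarrow> int \<Rightarrow> int" where
  "affine_of n \<pi> T x = int (\<pi> (residue n x))
     + int n * (of_bool (residue n x \<in> T) - of_bool (residue n x \<in> excedances n \<pi>))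
     + int n * ((x - 1) div int n)"

lemma affine_of_nat:
  assumes "r \<in> {1..n}"
  shows "affine_of n \<pi> T (int r + int n * k) =
    int (\<pi> r) + int n * (of_bool (r \<in> T) - of_bool (r \<in> excedances n \<pi>)) + int n * k"
  unfolding affine_of_def residue_eq[OF assms] quotient_eq[OF assms] ..

lemma affine_of_shift:
  assumes "n \<ge> 1"
  shows "affine_of n \<pi> T (x + int n * l) = affine_of n \<pi> T x + int n * l"
proof -
  obtain r k where r: "r \<in> {1..n}" and x: "x = int r + int n * k"
    using residue_range[OF assms] residue_decomp[OF assms] by blast
  have "x + int n * l = int r + int n * (k + l)" by (simp add: x algebra_simps)
  then show ?thesis by (simp only: x affine_of_nat[OF r])
qed

lemma residue_affine_of:
  assumes "\<pi> permutes {1..n}" "r \<in> {1..n}"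
  shows "residue n (affine_of n \<pi> T (int r + int n * k)) = \<pi> r"
proof -
  have "\<pi> r \<in> {1..n}" using assms by (simp only: permutes_in_image)
  then show ?thesis
    unfolding affine_of_nat[OF assms(2)] add.assoc distrib_left[symmetric] by (simp only: residue_eq)
qed

text \<open>\<open>\<pi>\<close> permutes the residue classes, and each class is mapped onto its
  image by a translation.\<close>

lemma bij_affine_of:
  assumes n: "n \<ge> 1" and \<pi>: "\<pi> permutes {1..n}"
  shows "bij (affine_of n \<pi> T)"
proof (rule bijI)
  show "inj (affine_of n \<pi> T)"
  proof (rule injI)
    fix x y assume eq: "affine_of n \<pi> T x = affine_of n \<pi> T y"
    obtain r k where r: "r \<in> {1..n}" and x: "x = int r + int n * k"
      using residue_range[OF n] residue_decomp[OF n] by blast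
    obtain s l where s: "s \<in> {1..n}" and y: "y = int s + int n * l"
      using residue_range[OF n] residue_decomp[OF n] by blast
    have "\<pi> r = \<pi> s"
      using residue_affine_of[OF \<pi> r] residue_affine_of[OF \<pi> s] eq x y by metis
    then have "r = s" using permutes_inj[OF \<pi>] by (simp add: inj_eq)
    moreover have "k = l"
      using eq n unfolding x y \<open>r = s\<close> affine_of_nat[OF s] by simp
    ultimately show "x = y" by (simp add: x y)
  qed
  show "surj (affine_of n \<pi> T)"
  proof (rule surjI)
    fix y
    define r where "r = inv \<pi> (residue n y)"
    have r: "r \<in> {1..n}"
      unfolding r_def using residue_range[OF n] permutes_inv[OF \<pi>] permutes_in_image by metis
    have \<pi>r: "\<pi> r = residue n y" by (simp add: r_def permutes_inverses[OF \<pi>])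
    define k where "k = (y - 1) div int n - (of_bool (r \<in> T) - of_bool (r \<in> excedances n \<pi>))"
    \<comment> \<open>The right inverse must be an explicit function of \<open>y\<close>: the
      residue is pulled back along \<open>\<pi>\<close>, and the quotient \<open>k\<close> undoes
      the correction at \<open>r\<close>.\<close>
    show "affine_of n \<pi> T (int (inv \<pi> (residue n y)) + int n * ((y - 1) div int n
        - (of_bool (inv \<pi> (residue n y) \<in> T) - of_bool (inv \<pi> (residue n y) \<in> excedances n \<pi>)))) = y"
      unfolding r_def[symmetric] k_def[symmetric] affine_of_nat[OF r] \<pi>r
      using residue_decomp[OF n, of y] by (simp add: k_def algebra_simps)
  qed
qed

text \<open>Permuting \<open>{1..n}\<close> leaves the sum unchanged, so only the corrections count:
  plus \<open>n\<close> for each element of \<open>T\<close>, minus \<open>n\<close> for each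
  excedance.\<close>

lemma sum_affine_of:
  assumes \<pi>: "\<pi> permutes {1..n}" and T: "T \<subseteq> {1..n}"
  shows "(\<Sum>i=1..int n. affine_of n \<pi> T i)
           = (\<Sum>i=1..int n. i) + int n * (int (card T) - int (card (excedances n \<pi>)))"
proof -
  have "(\<Sum>i=1..int n. affine_of n \<pi> T i)
      = (\<Sum>r=1..n. int (\<pi> r) + int n * (of_bool (r \<in> T) - of_bool (r \<in> excedances n \<pi>)))"
    unfolding sum_int_interval using affine_of_nat[of _ n \<pi> T 0] by (intro sum.cong) auto
  also have "\<dots> = (\<Sum>r=1..n. int (\<pi> r)) + int n * ((\<Sum>r=1..n. of_bool (r \<in> T))
      - (\<Sum>r=1..n. of_bool (r \<in> excedances n \<pi>)))"
    by (simp only: sum.distrib sum_distrib_left[symmetric] sum_subtractf)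
  also have "(\<Sum>r=1..n. int (\<pi> r)) = (\<Sum>r=1..n. int r)"
    using sum.permute[OF \<pi>, of int] by (simp add: o_def)
  also have "(\<Sum>r=1..n. of_bool (r \<in> T)) = int (card T)"
    using T by (simp add: Int_absorb2 Int_commute del: atLeastAtMost_iff)
  also have "(\<Sum>r=1..n. of_bool (r \<in> excedances n \<pi>)) = int (card (excedances n \<pi>))"
    using subset_trans[OF excedances_subset_moved moved_subset, of n \<pi>]
    by (simp add: Int_absorb2 Int_commute)
  finally show ?thesis by (simp only: sum_int_interval)
qed

text \<open>\<open>T\<close> avoids fixed points because raising one by \<open>n\<close> would break
  the strict bound; the cardinality condition encodes the prescribed sum.\<close>

definition marked_permutations :: "nat \<Rightarrow> ((nat \<Rightarrow> nat) \<times> nat set) set" where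
  "marked_permutations n = (SIGMA \<pi>:{\<pi>. \<pi> permutes {1..n}}.
     {T. T \<subseteq> moved n \<pi> \<and> card T = card (excedances n \<pi>)})"

text \<open>As \<open>\<pi> r\<close> lies in \<open>{1..n}\<close>, the value is
  \<open>\<pi> r\<close> or its shift by \<open>n\<close> to the other side of \<open>r\<close>. A
  shift occurs only if \<open>\<pi> r \<noteq> r\<close>, so the displacement stays below
  \<open>n\<close>.\<close>

lemma affine_of_cases:
  assumes \<pi>: "\<pi> permutes {1..n}" and T: "T \<subseteq> moved n \<pi>" and r: "r \<in> {1..n}"
  shows "\<bar>affine_of n \<pi> T (int r) - int r\<bar> < int n"
    and "int r < affine_of n \<pi> T (int r) \<longleftrightarrow> r \<in> T"
proof -
  have v: "affine_of n \<pi> T (int r) =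
      int (\<pi> r) + int n * (of_bool (r \<in> T) - of_bool (r \<in> excedances n \<pi>))"
    using affine_of_nat[OF r, of \<pi> T 0] by simp
  have "\<pi> r \<in> {1..n}" using \<pi> r by (simp only: permutes_in_image)
  moreover have "r \<in> T \<Longrightarrow> \<pi> r \<noteq> r" using T by (auto simp: moved_def)
  ultimately show "\<bar>affine_of n \<pi> T (int r) - int r\<bar> < int n"
    "int r < affine_of n \<pi> T (int r) \<longleftrightarrow> r \<in> T"
    unfolding v using r by (auto simp: excedances_def)
qed

lemma affine_of_bounded:
  assumes n: "n \<ge> 1" and "(\<pi>, T) \<in> marked_permutations n"
  shows "affine_of n \<pi> T \<in> bounded_affine_permutations n"
proof -
  have \<pi>: "\<pi> permutes {1..n}" and T: "T \<subseteq> moved n \<pi>" and card: "card T = card (excedances n \<pi>)"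
    using assms(2) by (auto simp: marked_permutations_def)
  have "affine_of n \<pi> T (i + int n) = affine_of n \<pi> T i + int n" for i
    using affine_of_shift[OF n, of \<pi> T i 1] by simp
  moreover have "(\<Sum>i=1..int n. affine_of n \<pi> T i) = (\<Sum>i=1..int n. i)"
    using sum_affine_of[OF \<pi> subset_trans[OF T moved_subset]] card by simp
  moreover have "\<bar>affine_of n \<pi> T i - i\<bar> < int n" for i
  proof -
    let ?r = "residue n i" and ?q = "(i - 1) div int n"
    \<comment> \<open>The displacement is \<open>n\<close>-periodic, so the bound is needed only on
      \<open>{1..n}\<close>.\<close>
    have "affine_of n \<pi> T i - i = affine_of n \<pi> T (int ?r) - int ?r"
      using affine_of_shift[OF n, of \<pi> T "int ?r" ?q] residue_decomp[OF n, of i]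
      by (metis add_diff_cancel_right)
    then show ?thesis using affine_of_cases(1)[OF \<pi> T residue_range[OF n, of i]] by simp
  qed
  ultimately show ?thesis
    by (auto simp: bounded_affine_permutations_def affine_permutation_def bij_affine_of[OF n \<pi>])
qed

lemma residue_perm_affine_of:
  assumes "\<pi> permutes {1..n}"
  shows "residue_perm n (affine_of n \<pi> T) = \<pi>"
proof
  fix r
  show "residue_perm n (affine_of n \<pi> T) r = \<pi> r"
    using residue_affine_of[OF assms, of r T 0] permutes_not_in[OF assms, of r]
    by (auto simp: residue_perm_def)
qed

lemma ascents_affine_of:
  assumes "\<pi> permutes {1..n}" "T \<subseteq> moved n \<pi>"
  shows "ascents n (affine_of n \<pi> T) = T"
  using affine_of_cases(2)[OF assms] assms(2) by (auto simp: ascents_def moved_def)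

text \<open>Equal residues of two values mean that the values differ by a multiple of
  \<open>n\<close>. Equivariance moves this multiple into the argument, and injectivity of
  \<open>\<sigma>\<close> makes the arguments congruent. Surjectivity follows by finiteness.\<close>

lemma residue_perm_permutes:
  assumes n: "n \<ge> 1" and "bij \<sigma>" and shift: "\<And>i. \<sigma> (i + int n) = \<sigma> i + int n"
  shows "residue_perm n \<sigma> permutes {1..n}"
proof (rule bij_imp_permutes)
  have "inj_on (residue_perm n \<sigma>) {1..n}"
  proof (rule inj_onI)
    fix r s assume r: "r \<in> {1..n}" and s: "s \<in> {1..n}" and "residue_perm n \<sigma> r = residue_perm n \<sigma> s"
    then have "residue n (\<sigma> (int r)) = residue n (\<sigma> (int s))" by (simp add: residue_perm_def)
    then have "\<sigma> (int r) = \<sigma> (int s)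
        + int n * ((\<sigma> (int r) - 1) div int n - (\<sigma> (int s) - 1) div int n)"
      using residue_decomp[OF n, of "\<sigma> (int r)"] residue_decomp[OF n, of "\<sigma> (int s)"]
      unfolding right_diff_distrib by linarith
    then obtain k where "\<sigma> (int r) = \<sigma> (int s) + int n * k" ..
    then have "\<sigma> (int r) = \<sigma> (int s + int n * k)" by (simp add: shift_multiple[of \<sigma> n, OF shift])
    then have "int r = int s + int n * k" using \<open>bij \<sigma>\<close> by (simp add: bij_is_inj inj_eq)
    then have "residue n (int r) = residue n (int s + int n * k)" by (rule arg_cong)
    moreover have "residue n (int r) = r" using residue_eq[OF r, of 0] by simp
    moreover have "residue n (int s + int n * k) = s" by (rule residue_eq[OF s])
    ultimately show "r = s" by metis
  qed
  moreover have "residue_perm n \<sigma> ` {1..n} \<subseteq> {1..n}"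
    using residue_range[OF n] by (auto simp: residue_perm_def simp del: atLeastAtMost_iff)
  ultimately show "bij_betw (residue_perm n \<sigma>) {1..n} {1..n}"
    by (simp add: bij_betw_def endo_inj_surj)
qed (simp only: residue_perm_def if_False)

lemma affine_of_residue_perm:
  assumes n: "n \<ge> 1" and shift: "\<And>i. \<sigma> (i + int n) = \<sigma> i + int n"
    and bound: "\<And>i. \<bar>\<sigma> i - i\<bar> < int n"
  shows "affine_of n (residue_perm n \<sigma>) (ascents n \<sigma>) = \<sigma>"
proof (rule shift_equivariant_ext[OF n])
  let ?\<pi> = "residue_perm n \<sigma>"
  show "affine_of n ?\<pi> (ascents n \<sigma>) (i + int n) = affine_of n ?\<pi> (ascents n \<sigma>) i + int n" for i
    using affine_of_shift[OF n, of _ _ i 1] by simp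
  fix r assume r: "r \<in> {1..n}"
  define q where "q = (\<sigma> (int r) - 1) div int n"
  have \<pi>r: "?\<pi> r \<in> {1..n}" using r residue_range[OF n] by (simp add: residue_perm_def)
  have \<sigma>r: "\<sigma> (int r) = int (?\<pi> r) + int n * q"
    using r residue_decomp[OF n, of "\<sigma> (int r)"] by (simp add: residue_perm_def q_def)
  have "\<bar>int (?\<pi> r) - int r + int n * q\<bar> < int n" using bound[of "int r"] \<sigma>r by simp
  moreover have "\<bar>int (?\<pi> r) - int r\<bar> < int n" using r \<pi>r by auto
  \<comment> \<open>Two displacements below \<open>n\<close> in absolute value differ by less than
    \<open>2 n\<close>, leaving three possible quotients.\<close>
  ultimately have "int n * q < int n * 2" "int n * (- 2) < int n * q" by linarith+
  then have "q < 2" "- 2 < q" using n by (simp_all only: mult_less_cancel_left_pos)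
  then consider "q = -1" | "q = 0" | "q = 1" by linarith
  \<comment> \<open>For \<open>q = 1\<close> there is an ascent at \<open>r\<close>, and the bound
    forces \<open>?\<pi> r < r\<close>; \<open>q = -1\<close> is the mirror case. For
    \<open>q = 0\<close> ascent and excedance coincide.\<close>
  then have "q = of_bool (r \<in> ascents n \<sigma>) - of_bool (r \<in> excedances n ?\<pi>)"
    using r \<pi>r \<sigma>r bound[of "int r"] by cases (auto simp: ascents_def excedances_def)
  then show "affine_of n ?\<pi> (ascents n \<sigma>) (int r) = \<sigma> (int r)"
    using affine_of_nat[OF r, of ?\<pi> "ascents n \<sigma>" 0] \<sigma>r by simp
qed (rule shift)

lemma residue_perm_ascents_marked:
  assumes n: "n \<ge> 1" and "\<sigma> \<in> bounded_affine_permutations n"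
  shows "(residue_perm n \<sigma>, ascents n \<sigma>) \<in> marked_permutations n"
proof -
  let ?\<pi> = "residue_perm n \<sigma>"
  have \<sigma>: "bij \<sigma>" and shift: "\<And>i. \<sigma> (i + int n) = \<sigma> i + int n"
    and sum: "(\<Sum>i=1..int n. \<sigma> i) = (\<Sum>i=1..int n. i)" and bound: "\<And>i. \<bar>\<sigma> i - i\<bar> < int n"
    using assms(2) by (auto simp: bounded_affine_permutations_def affine_permutation_def)
  have \<pi>: "?\<pi> permutes {1..n}" by (rule residue_perm_permutes) (use n \<sigma> shift in auto)
  have "ascents n \<sigma> \<subseteq> {1..n}" by (auto simp: ascents_def)
  \<comment> \<open>Since \<open>\<sigma>\<close> is recovered from its residues and ascents, the
    sum formula applies to \<open>\<sigma>\<close> itself; its prescribed sum forces the correction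
    to vanish.\<close>
  from sum_affine_of[OF \<pi> this] have "card (ascents n \<sigma>) = card (excedances n ?\<pi>)"
    unfolding affine_of_residue_perm[of n \<sigma>, OF n shift bound] sum using n by simp
  moreover have "r \<in> moved n ?\<pi>" if "r \<in> ascents n \<sigma>" for r
  proof -
    have r: "r \<in> {1..n}" "int r < \<sigma> (int r)" using that by (auto simp: ascents_def)
    have "?\<pi> r \<noteq> r"
    proof
      assume "?\<pi> r = r"
      then have "\<sigma> (int r) - int r = int n * ((\<sigma> (int r) - 1) div int n)"
        using r residue_decomp[OF n, of "\<sigma> (int r)"] by (simp add: residue_perm_def)
      then have "int n dvd \<sigma> (int r) - int r" by simp
      \<comment> \<open>At an ascent the displacement is positive, so as a multiple of
        \<open>n\<close> it would be at least \<open>n\<close>.\<close>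
      then show False using zdvd_imp_le[of "int n"] r bound[of "int r"] by fastforce
    qed
    then show ?thesis using r by (simp add: moved_def)
  qed
  ultimately show ?thesis using \<pi> by (auto simp: marked_permutations_def)
qed

section \<open>Counting through marked permutations\<close>

lemma card_bounded_affine_permutations:
  assumes n: "n \<ge> 1"
  shows "card (bounded_affine_permutations n) = card (marked_permutations n)"
proof -
  have "bij_betw (\<lambda>(\<pi>, T). affine_of n \<pi> T) (marked_permutations n) (bounded_affine_permutations n)"
  proof (rule bij_betw_byWitness[where f' = "\<lambda>\<sigma>. (residue_perm n \<sigma>, ascents n \<sigma>)"])
    show "\<forall>p\<in>marked_permutations n. (\<lambda>\<sigma>. (residue_perm n \<sigma>, ascents n \<sigma>))
        ((\<lambda>(\<pi>, T). affine_of n \<pi> T) p) = p"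
      by (auto simp: marked_permutations_def residue_perm_affine_of ascents_affine_of)
    show "\<forall>\<sigma>\<in>bounded_affine_permutations n. (\<lambda>(\<pi>, T). affine_of n \<pi> T)
        (residue_perm n \<sigma>, ascents n \<sigma>) = \<sigma>"
      using affine_of_residue_perm[OF n]
      by (auto simp: bounded_affine_permutations_def affine_permutation_def)
    show "(\<lambda>(\<pi>, T). affine_of n \<pi> T) ` marked_permutations n \<subseteq> bounded_affine_permutations n"
      using affine_of_bounded[OF n] by auto
    show "(\<lambda>\<sigma>. (residue_perm n \<sigma>, ascents n \<sigma>)) ` bounded_affine_permutations n
        \<subseteq> marked_permutations n"
      using residue_perm_ascents_marked[OF n] by auto
  qed
  then show ?thesis by (simp add: bij_betw_same_card)
qed

lemma card_marked_permutations:
  "card (marked_permutations n)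
     = (\<Sum>\<pi> | \<pi> permutes {1..n}. card (moved n \<pi>) choose card (excedances n \<pi>))"
proof -
  have fin: "finite (moved n \<pi>)" for \<pi> by (rule finite_subset[OF moved_subset]) simp
  show ?thesis
    unfolding marked_permutations_def
    by (subst card_SigmaI) (auto simp: finite_permutations n_subsets fin)
qed

theorem theorem6p4:
  fixes n :: nat
  assumes "n \<ge> 1"
  shows "card (bounded_affine_permutations n)
           = (\<Sum>m=0..n. (n choose m) * (\<Sum>k=0..m. (m choose k) * num_derangements_exc m k))
       \<and> int (card (bounded_affine_permutations n))
           = (\<Sum>m=0..n. int (n choose m) *
               (\<Sum>k=0..m. int (m choose (n - k)) * (-1) ^ (n - m) * int (num_perms_exc m k)))"
proof -
  have "card (bounded_affine_permutations n)
      = (\<Sum>m=0..n. (n choose m) * (\<Sum>k=0..m. (m choose k) * num_derangements_exc m k))"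
    \<comment> \<open>The weight \<open>choose\<close> counts the admissible \<open>T\<close> for
      each \<open>\<pi>\<close>, which gives (a); (b) is then a rewriting of the sum.\<close>
    using card_bounded_affine_permutations[OF assms] card_marked_permutations[of n]
      sum_permutations_by_moved[of "(choose)" n] by simp
  then show ?thesis by (simp only: sum_derangements_eq_alternating_sum_permutations)
qed

end
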